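(* Let $G=(V_G,E_G)$ and $H=(V_H,E_H)$ be finite simple connected graphs, with $V_G=\{x_1,\ldots,x_n\}$ and $|V_H|=m$. For any vertices $u=(y_1,\ldots,y_n)x$ and $v=(y'_1,\ldots,y'_n)x'$ of $G\wr H$, writing $y=(y_1,\ldots,y_n)$ and $y'=(y'_1,\ldots,y'_n)$, $$d_{G\wr H}(u,v)=d_{H^{\Box n}}(y,y')+\rho_{\delta(y,y')}(x,x')=\sum_{i=1}^n d_H(y_i,y'_i)+\rho_{\delta(y,y')}(x,x').$$
   Context: The wreath product $G\wr H$ has vertex set $\{(f,v): f:V_G\to V_H,\ v\in V_G\}$; $(f,v)$ and $(f',v')$ are adjacent iff either $v=v'$, $f(w)=f'(w)$ for $w\neq v$ and $f(v)\sim f'(v)$ in $H$, or $f=f'$ and $v\sim v'$ in $G$. Using the enumeration of $V_G$, the vertex $(f,x_i)$ is written $(y_1,\ldots,y_n)x_i$ with $y_j=f(x_j)$. $d_X$ denotes geodesic distance in a graph $X$; $H^{\Box n}$ is the $n$-fold Cartesian power of $H$ (vertex set $(V_H)^n$, two tuples adjacent iff they differ in exactly one coordinate, where the entries are adjacent in $H$). For $y,y'\in(V_H)^n$, $\delta(y,y')=\{x_i\in V_G: y_i\neq y'_i\}$. For $A\subseteq V_G$ and $a,b\in V_G$, $\rho_A(a,b)$ is the minimum length of a walk in $G$ from $a$ to $b$ (vertex repetitions allowed, length $\ge0$) visiting every vertex of $A$. *)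

theory Defs
  imports
    "Graph_Theory.Digraph_Component"
    "HOL-Library.FuncSet"
    "HOL-Library.Extended_Nat"
begin

text \<open>
  A finite simple graph is a \<^locale>\<open>pair_graph\<close>: a finite loop-free digraph whose arcs are a
  symmetric set of ordered pairs. Functions with a prescribed domain, and n-tuples as functions on
  \<open>{1..n}\<close>, are extensional (\<open>\<rightarrow>\<^sub>E\<close>), so that they are equal iff they agree on the domain.
\<close>

definition wreath :: "'a pair_pre_digraph \<Rightarrow> 'b pair_pre_digraph \<Rightarrow> (('a \<Rightarrow> 'b) \<times> 'a) pair_pre_digraph"
  where
  "wreath G H =
    (let V = (pverts G \<rightarrow>\<^sub>E pverts H) \<times> pverts G in
     \<lparr> pverts = V,
       parcs = {((f, v), (f', v')). (f, v) \<in> V \<and> (f', v') \<in> V \<and>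
         (v = v' \<and> (\<forall>w \<in> pverts G. w \<noteq> v \<longrightarrow> f w = f' w) \<and> (f v, f' v) \<in> parcs H \<or>
          f = f' \<and> (v, v') \<in> parcs G)} \<rparr>)"

definition box_power :: "nat \<Rightarrow> 'b pair_pre_digraph \<Rightarrow> (nat \<Rightarrow> 'b) pair_pre_digraph"
  where
  "box_power n H =
    (let V = {1..n} \<rightarrow>\<^sub>E pverts H in
     \<lparr> pverts = V,
       parcs = {(y, y'). y \<in> V \<and> y' \<in> V \<and>
         (\<exists>i \<in> {1..n}. {j \<in> {1..n}. y j \<noteq> y' j} = {i} \<and> (y i, y' i) \<in> parcs H)} \<rparr>)"

text \<open>The infimum of the empty set is \<open>\<infinity>\<close>, so distinct components are at infinite distance.\<close>

definition geodist :: "'a pair_pre_digraph \<Rightarrow> 'a \<Rightarrow> 'a \<Rightarrow> enat"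
  where
  "geodist X u v = (INF p \<in> {p. pre_digraph.awalk (with_proj X) u p v}. enat (length p))"

definition visit_dist :: "'a pair_pre_digraph \<Rightarrow> 'a set \<Rightarrow> 'a \<Rightarrow> 'a \<Rightarrow> enat"
  where
  "visit_dist X A a b =
    (INF p \<in> {p. pre_digraph.awalk (with_proj X) a p b \<and>
                 A \<subseteq> set (pre_digraph.awalk_verts (with_proj X) a p)}. enat (length p))"

text \<open>
  With respect to an enumeration \<open>x\<close> of the vertices by \<open>{1..n}\<close>, \<open>coords n x f\<close> is the tuple
  \<open>(y\<^sub>1, \<dots>, y\<^sub>n)\<close> with \<open>y\<^sub>j = f x\<^sub>j\<close>.
\<close>

definition coords :: "nat \<Rightarrow> (nat \<Rightarrow> 'a) \<Rightarrow> ('a \<Rightarrow> 'b) \<Rightarrow> nat \<Rightarrow> 'b"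
  where
  "coords n x f = (\<lambda>j \<in> {1..n}. f (x j))"

definition diff_set :: "nat \<Rightarrow> (nat \<Rightarrow> 'a) \<Rightarrow> (nat \<Rightarrow> 'b) \<Rightarrow> (nat \<Rightarrow> 'b) \<Rightarrow> 'a set"
  where
  "diff_set n x y y' = {x i |i. i \<in> {1..n} \<and> y i \<noteq> y' i}"

lemma pair_graph_wreath:
  assumes "pair_graph G" "pair_graph H"
  shows "pair_graph (wreath G H)"
proof -
  interpret G: pair_graph G by fact
  interpret H: pair_graph H by fact
  have fin: "finite (pverts (wreath G H))"
    by (auto simp: wreath_def Let_def G.pair_finite_verts H.pair_finite_verts
        intro!: finite_cartesian_product finite_PiE)
  have sub: "parcs (wreath G H) \<subseteq> pverts (wreath G H) \<times> pverts (wreath G H)"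
    by (auto simp: wreath_def Let_def)
  have sy: "sym (parcs (wreath G H))"
    by (rule symI) (auto simp: wreath_def Let_def G.arcs_symmetric H.arcs_symmetric)
  have lf: "e \<in> parcs (wreath G H) \<Longrightarrow> fst e \<noteq> snd e" for e
    by (auto simp: wreath_def Let_def dest: G.no_loops' H.no_loops')
  show ?thesis
    using sub fin finite_subset[OF sub] sy lf
    by unfold_locales (auto simp: symmetric_def)
qed

lemma pair_graph_box_power:
  assumes "pair_graph H"
  shows "pair_graph (box_power n H)"
proof -
  interpret H: pair_graph H by fact
  have fin: "finite (pverts (box_power n H))"
    by (auto simp: box_power_def Let_def H.pair_finite_verts intro!: finite_PiE)
  have sub: "parcs (box_power n H) \<subseteq> pverts (box_power n H) \<times> pverts (box_power n H)"
    by (auto simp: box_power_def Let_def)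
  have sy: "sym (parcs (box_power n H))"
  proof (rule symI)
    fix y y' assume "(y, y') \<in> parcs (box_power n H)"
    moreover have "{j \<in> {1..n}. y' j \<noteq> y j} = {j \<in> {1..n}. y j \<noteq> y' j}" by auto
    ultimately show "(y', y) \<in> parcs (box_power n H)"
      by (auto simp: box_power_def Let_def intro: H.arcs_symmetric)
  qed
  have lf: "e \<in> parcs (box_power n H) \<Longrightarrow> fst e \<noteq> snd e" for e
    by (auto simp: box_power_def Let_def)
  show ?thesis
    using sub fin finite_subset[OF sub] sy lf
    by unfold_locales (auto simp: symmetric_def)
qed

end

theory Submission
  imports Defs
begin

text \<open>
  Upper bound: follow a walk in \<open>G\<close> that visits every vertex where \<open>f\<close> and \<open>f'\<close> differ, and at each
  vertex \<open>w\<close> move the entry \<open>f w\<close> along a geodesic of \<open>H\<close> to \<open>f' w\<close>. Lower bound: the right-hand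
  side, as a function of the starting vertex, vanishes at the target and drops by at most \<open>1\<close>
  along each arc; for an arc that changes the entry at \<open>v\<close> this holds because a walk starting at \<open>v\<close>
  visits \<open>v\<close> anyway.
\<close>

section \<open>Walks that must visit a given set, and their minimal length\<close>

lemma pair_awalk_Cons:
  assumes "pair_graph X"
  shows "pre_digraph.awalk (with_proj X) u ((v, w) # p) z \<longleftrightarrow>
    v = u \<and> (u, w) \<in> parcs X \<and> pre_digraph.awalk (with_proj X) w p z"
proof -
  interpret pair_graph X by fact
  show ?thesis by (auto simp: awalk_Cons_iff)
qed

lemma pair_awalk_Nil:
  assumes "pair_graph X"
  shows "pre_digraph.awalk (with_proj X) u [] z \<longleftrightarrow> u = z \<and> u \<in> pverts X"
proof -
  interpret pair_graph X by fact
  show ?thesis by (auto simp: awalk_Nil_iff)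
qed

text \<open>With nothing to visit, the covering condition is vacuous. Facts about
  \<open>visit_dist\<close> thus specialise to \<open>geodist\<close>.\<close>

lemma geodist_eq_visit_dist: "geodist X = visit_dist X {}"
  by (simp add: geodist_def visit_dist_def fun_eq_iff)

lemma visit_dist_le_walk:
  assumes "pre_digraph.awalk (with_proj X) u p v"
    and "A \<subseteq> set (pre_digraph.awalk_verts (with_proj X) u p)"
  shows "visit_dist X A u v \<le> enat (length p)"
  using assms by (auto simp: visit_dist_def intro: INF_lower)

text \<open>A finite value rules out an empty set of walks, whose infimum is
  \<open>\<infinity>\<close>; the infimum of a nonempty set of \<open>enat\<close> is a least
  element. This yields an optimal walk to work with.\<close>

lemma visit_dist_attained:
  assumes "visit_dist X A u v \<noteq> \<infinity>"
  obtains p where "pre_digraph.awalk (with_proj X) u p v"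
    and "A \<subseteq> set (pre_digraph.awalk_verts (with_proj X) u p)"
    and "visit_dist X A u v = enat (length p)"
proof -
  define S where "S = (\<lambda>p. enat (length p)) ` {p. pre_digraph.awalk (with_proj X) u p v \<and>
    A \<subseteq> set (pre_digraph.awalk_verts (with_proj X) u p)}"
  have eq: "visit_dist X A u v = Inf S"
    by (simp add: visit_dist_def S_def)
  with assms have ne: "S \<noteq> {}" by (auto simp: Inf_enat_def)
  then have "Inf S \<in> S"
    by (auto simp: Inf_enat_def intro: LeastI)
  with eq that show ?thesis by (auto simp: S_def)
qed

text \<open>Prepending the arc to an optimal walk from \<open>v\<close> costs one step and loses no
  visited vertex. This supplies the step condition of \<open>potential_le_geodist\<close> for arcs
  that move in \<open>G\<close>.\<close>

lemma visit_dist_step: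
  assumes "pair_graph X" and "(u, v) \<in> parcs X"
  shows "visit_dist X A u w \<le> 1 + visit_dist X A v w"
proof (cases "visit_dist X A v w = \<infinity>")
  case False
  obtain p where p: "pre_digraph.awalk (with_proj X) v p w"
    "A \<subseteq> set (pre_digraph.awalk_verts (with_proj X) v p)"
    "visit_dist X A v w = enat (length p)"
    using False by (rule visit_dist_attained)
  have "visit_dist X A u w \<le> enat (length ((u, v) # p))"
    using p assms by (intro visit_dist_le_walk) (auto simp: pair_awalk_Cons pre_digraph.awalk_verts.simps)
  then show ?thesis using p(3) by (simp add: one_enat_def add.commute)
qed simp

text \<open>Every walk from \<open>u\<close> lists \<open>u\<close> among its vertices, the empty
  walk included, so both infima range over the same walks.\<close>

lemma visit_dist_insert_start:
  assumes "pair_graph X"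
  shows "visit_dist X (insert u A) u v = visit_dist X A u v"
proof -
  have "u \<in> set (pre_digraph.awalk_verts (with_proj X) u p)"
    if "pre_digraph.awalk (with_proj X) u p v" for p
    using that assms by (cases p) (auto simp: pair_awalk_Cons pre_digraph.awalk_verts.simps)
  then show ?thesis
    unfolding visit_dist_def by (intro INF_cong) auto
qed

lemma visit_dist_mono:
  "A \<subseteq> B \<Longrightarrow> visit_dist X A u v \<le> visit_dist X B u v"
  unfolding visit_dist_def by (rule INF_superset_mono) auto

section \<open>Geodesic distance and the tools for bounding it\<close>

lemma geodist_refl:
  assumes "pair_graph X" "u \<in> pverts X"
  shows "geodist X u u = 0"
proof -
  have "geodist X u u \<le> enat (length ([] :: ('a \<times> 'a) list))"
    unfolding geodist_eq_visit_dist
    using assms by (intro visit_dist_le_walk) (auto simp: pair_awalk_Nil)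
  then show ?thesis by (simp add: zero_enat_def[symmetric])
qed

lemma geodist_step:
  assumes "pair_graph X" and "(u, v) \<in> parcs X"
  shows "geodist X u w \<le> 1 + geodist X v w"
  using visit_dist_step[OF assms] by (simp add: geodist_eq_visit_dist)

lemma geodist_triangle:
  assumes "pair_graph X"
  shows "geodist X u w \<le> geodist X u v + geodist X v w"
proof (cases "geodist X u v = \<infinity> \<or> geodist X v w = \<infinity>")
  case False
  interpret pair_graph X by fact
  obtain p where p: "awalk u p v" "geodist X u v = enat (length p)"
    using False visit_dist_attained unfolding geodist_eq_visit_dist by metis
  obtain q where q: "awalk v q w" "geodist X v w = enat (length q)"
    using False visit_dist_attained unfolding geodist_eq_visit_dist by metis
  have "geodist X u w \<le> enat (length (p @ q))"
    unfolding geodist_eq_visit_dist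
    using p q by (intro visit_dist_le_walk) auto
  then show ?thesis using p q by simp
qed auto

text \<open>The tool for lower bounds: along any walk to \<open>z\<close> the value of
  \<open>\<phi>\<close> falls by at most 1 per arc and ends at 0, so the walk has at least
  \<open>\<phi> u\<close> arcs. If there is no walk, the distance is \<open>\<infinity>\<close> and
  the bound is trivial.\<close>

lemma potential_le_geodist:
  fixes \<phi> :: "'a \<Rightarrow> enat"
  assumes "pair_graph X" and "\<phi> z = 0"
    and step: "\<And>u v. (u, v) \<in> parcs X \<Longrightarrow> \<phi> u \<le> 1 + \<phi> v"
  shows "\<phi> u \<le> geodist X u z"
  unfolding geodist_def
proof (rule INF_greatest, clarify)
  fix p assume "pre_digraph.awalk (with_proj X) u p z"
  then show "\<phi> u \<le> enat (length p)"
  proof (induction p arbitrary: u)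
    case Nil
    then show ?case using assms by (simp add: pair_awalk_Nil)
  next
    case (Cons e p)
    obtain v w where [simp]: "e = (v, w)" by fastforce
    have "(u, w) \<in> parcs X" "\<phi> w \<le> enat (length p)"
      using Cons by (auto simp: pair_awalk_Cons[OF assms(1)])
    then have "\<phi> u \<le> 1 + enat (length p)"
      by (meson step add_left_mono order_trans)
    then show ?case by (simp add: one_enat_def)
  qed
qed

text \<open>A homomorphism carries walks to walks of the same length. It is applied to maps that
  place \<open>H\<close> into a product by letting a single entry vary.\<close>

lemma geodist_hom_le:
  assumes "pair_graph X" "pair_graph Y"
    and "\<And>v. v \<in> pverts X \<Longrightarrow> h v \<in> pverts Y"
    and "\<And>v w. (v, w) \<in> parcs X \<Longrightarrow> (h v, h w) \<in> parcs Y"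
  shows "geodist Y (h u) (h z) \<le> geodist X u z"
  unfolding geodist_def[of X]
proof (rule INF_greatest, clarify)
  fix p assume "pre_digraph.awalk (with_proj X) u p z"
  then show "geodist Y (h u) (h z) \<le> enat (length p)"
  proof (induction p arbitrary: u)
    case Nil
    then show ?case using assms by (auto simp: pair_awalk_Nil geodist_refl)
  next
    case (Cons e p)
    obtain v w where [simp]: "e = (v, w)" by fastforce
    have "(u, w) \<in> parcs X" "geodist Y (h w) (h z) \<le> enat (length p)"
      using Cons by (auto simp: pair_awalk_Cons[OF assms(1)])
    then have "geodist Y (h u) (h z) \<le> 1 + enat (length p)"
      using geodist_step[OF assms(2) assms(4)] by (meson add_left_mono order_trans)
    then show ?case by (simp add: one_enat_def)
  qed
qed

text \<open>An arc that changes one entry affects one summand only. Splitting off that summand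
  avoids subtraction, which is delicate in \<open>enat\<close>.\<close>

lemma sum_le_one_plus_sum:
  fixes g h :: "'i \<Rightarrow> enat"
  assumes "finite S" and "i \<in> S" and "g i \<le> 1 + h i" and "\<And>j. j \<in> S - {i} \<Longrightarrow> g j = h j"
  shows "sum g S \<le> 1 + sum h S"
proof -
  have "sum g S = g i + sum h (S - {i})"
    using assms by (simp add: sum.remove[of S i])
  also have "\<dots> \<le> (1 + h i) + sum h (S - {i})"
    using assms(3) by (rule add_right_mono)
  also have "\<dots> = 1 + sum h S"
    using assms by (simp add: sum.remove[of S i] add.assoc)
  finally show ?thesis .
qed

section \<open>Distance in the Cartesian power\<close>

lemma pverts_box_power [simp]: "pverts (box_power n H) = {1..n} \<rightarrow>\<^sub>E pverts H"
  by (simp add: box_power_def Let_def)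

text \<open>Varying coordinate \<open>i\<close> alone places a copy of \<open>H\<close> in the
  power. Since \<open>H\<close> has no loops, the two tuples really differ at \<open>i\<close>, as
  the arcs of \<open>box_power\<close> require.\<close>

lemma box_power_arc_update:
  assumes "pair_graph H" "y \<in> {1..n} \<rightarrow>\<^sub>E pverts H" "i \<in> {1..n}" "(b, c) \<in> parcs H"
  shows "(y(i := b), y(i := c)) \<in> parcs (box_power n H)"
proof -
  interpret H: pair_graph H by fact
  have "b \<noteq> c" "b \<in> pverts H" "c \<in> pverts H"
    using assms(4) by (auto dest: H.no_loops' H.in_arcsD1 H.in_arcsD2)
  moreover from this have "{j \<in> {1..n}. (y(i := b)) j \<noteq> (y(i := c)) j} = {i}"
    using assms(3) by auto
  ultimately show ?thesis
    using assms unfolding box_power_def Let_def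
    by (auto simp: PiE_iff extensional_def intro!: bexI[of _ i])
qed

lemma geodist_box_power:
  assumes H: "pair_graph H"
    and y: "y \<in> {1..n} \<rightarrow>\<^sub>E pverts H" and y': "y' \<in> {1..n} \<rightarrow>\<^sub>E pverts H"
  shows "geodist (box_power n H) y y' = (\<Sum>i = 1..n. geodist H (y i) (y' i))"
proof (rule antisym)
  note B = pair_graph_box_power[OF H, of n]
  \<comment> \<open>Coordinates are corrected one at a time: \<open>override_on y y' S\<close> is
    the tuple already equal to \<open>y'\<close> on \<open>S\<close> and still equal to
    \<open>y\<close> elsewhere.\<close>
  have partial: "geodist (box_power n H) y (override_on y y' S) \<le> (\<Sum>i\<in>S. geodist H (y i) (y' i))"
    if "finite S" "S \<subseteq> {1..n}" for S
    using that
  proof (induction S rule: finite_induct)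
    case empty
    then show ?case using B y by (simp add: geodist_refl)
  next
    case (insert i S)
    let ?z = "override_on y y' S"
    have z: "?z \<in> {1..n} \<rightarrow>\<^sub>E pverts H"
      using y y' by (auto simp: PiE_iff override_on_def extensional_def)
    have i: "i \<in> {1..n}" using insert by auto
    have "geodist (box_power n H) (?z(i := y i)) (?z(i := y' i)) \<le> geodist H (y i) (y' i)"
      using H B y i z
      by (intro geodist_hom_le[where h = "\<lambda>b. ?z(i := b)"] box_power_arc_update)
        (auto simp: PiE_iff extensional_def)
    \<comment> \<open>As \<open>i\<close> is not in \<open>S\<close>, coordinate \<open>i\<close> of
      \<open>?z\<close> still has its initial value.\<close>
    moreover have "?z(i := y i) = ?z"
      using insert by (auto simp: override_on_def)
    moreover have "?z(i := y' i) = override_on y y' (insert i S)"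
      by (auto simp: override_on_def)
    ultimately have last: "geodist (box_power n H) ?z (override_on y y' (insert i S))
      \<le> geodist H (y i) (y' i)" by simp
    have "geodist (box_power n H) y ?z \<le> (\<Sum>i\<in>S. geodist H (y i) (y' i))"
      using insert by simp
    from order_trans[OF geodist_triangle[OF B] add_mono[OF this last]]
    show ?case using insert by (simp add: add.commute)
  qed
  have "override_on y y' {1..n} = y'"
    using y y' by (auto simp: override_on_def PiE_iff extensional_def)
  then show "geodist (box_power n H) y y' \<le> (\<Sum>i = 1..n. geodist H (y i) (y' i))"
    using partial[of "{1..n}"] by simp
next
  show "(\<Sum>i = 1..n. geodist H (y i) (y' i)) \<le> geodist (box_power n H) y y'"
  \<comment> \<open>The potential is the coordinatewise distance to the fixed tuple
    \<open>y'\<close>; an arc changes one summand, by at most 1.\<close>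
  proof (rule potential_le_geodist[where \<phi> = "\<lambda>y. \<Sum>i = 1..n. geodist H (y i) (y' i)"])
    show "pair_graph (box_power n H)" using H by (rule pair_graph_box_power)
    show "(\<Sum>i = 1..n. geodist H (y' i) (y' i)) = 0"
      using y' by (intro sum.neutral ballI geodist_refl[OF H]) auto
  next
    fix u v assume "(u, v) \<in> parcs (box_power n H)"
    then obtain i where i: "i \<in> {1..n}" "{j \<in> {1..n}. u j \<noteq> v j} = {i}" "(u i, v i) \<in> parcs H"
      by (auto simp: box_power_def Let_def)
    then have "u j = v j" if "j \<in> {1..n} - {i}" for j
      using that by blast
    with i show "(\<Sum>i = 1..n. geodist H (u i) (y' i)) \<le> 1 + (\<Sum>i = 1..n. geodist H (v i) (y' i))"
      by (intro sum_le_one_plus_sum[of _ i] geodist_step[OF H]) auto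
  qed
qed

section \<open>Distance in the wreath product\<close>

lemma pverts_wreath [simp]: "pverts (wreath G H) = (pverts G \<rightarrow>\<^sub>E pverts H) \<times> pverts G"
  by (simp add: wreath_def Let_def)

text \<open>Sending \<open>b\<close> to \<open>(f(a := b), a)\<close> is a homomorphism from
  \<open>H\<close>, so a geodesic of \<open>H\<close> from \<open>f a\<close> to \<open>c\<close>
  can be followed while standing at \<open>a\<close>.\<close>

lemma geodist_wreath_update:
  assumes G: "pair_graph G" and H: "pair_graph H"
    and f: "f \<in> pverts G \<rightarrow>\<^sub>E pverts H" and a: "a \<in> pverts G"
  shows "geodist (wreath G H) (f, a) (f(a := c), a) \<le> geodist H (f a) c"
proof -
  interpret H: pair_graph H by fact
  have "geodist (wreath G H) (f(a := f a), a) (f(a := c), a) \<le> geodist H (f a) c"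
    using pair_graph_wreath[OF G H] f a H
    by (intro geodist_hom_le[where h = "\<lambda>b. (f(a := b), a)"])
      (auto simp: wreath_def Let_def PiE_iff extensional_def dest: H.in_arcsD1 H.in_arcsD2)
  then show ?thesis by simp
qed

text \<open>The upper bound for one covering walk. The induction runs along the walk with the target
  fixed; \<open>f\<close> and \<open>a\<close> vary, because each stage corrects an entry and then
  moves on.\<close>

lemma geodist_wreath_le_walk:
  assumes G: "pair_graph G" and H: "pair_graph H"
    and f': "f' \<in> pverts G \<rightarrow>\<^sub>E pverts H"
    and "f \<in> pverts G \<rightarrow>\<^sub>E pverts H"
    and "pre_digraph.awalk (with_proj G) a p a'"
    and "{w \<in> pverts G. f w \<noteq> f' w} \<subseteq> set (pre_digraph.awalk_verts (with_proj G) a p)"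
  shows "geodist (wreath G H) (f, a) (f', a')
    \<le> (\<Sum>w\<in>pverts G. geodist H (f w) (f' w)) + enat (length p)"
  using assms(4-)
proof (induction p arbitrary: f a)
  case Nil
  have a: "a = a'" "a \<in> pverts G" using Nil G by (auto simp: pair_awalk_Nil)
  interpret G: pair_graph G by fact
  \<comment> \<open>The empty walk visits only \<open>a\<close>, so \<open>a\<close> is the only
    vertex where \<open>f\<close> and \<open>f'\<close> can differ. Outside \<open>pverts G\<close>
    both are undefined by extensionality.\<close>
  have "f w = f' w" if "w \<in> pverts G" "w \<noteq> a" for w
    using Nil(3) that by (auto simp: pre_digraph.awalk_verts.simps)
  then have "f(a := f' a) = f'"
    using Nil(1) f' by (intro ext) (metis PiE_arb fun_upd_apply)
  then have "geodist (wreath G H) (f, a) (f', a') \<le> geodist H (f a) (f' a)"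
    using geodist_wreath_update[OF G H Nil(1) a(2), of "f' a"] a by simp
  also have "\<dots> \<le> (\<Sum>w\<in>pverts G. geodist H (f w) (f' w))"
    using a by (intro member_le_sum) auto
  finally show ?case by (simp add: zero_enat_def[symmetric])
next
  case (Cons e p)
  interpret G: pair_graph G by fact
  obtain v where e: "e = (a, v)" and av: "(a, v) \<in> parcs G"
    and p: "pre_digraph.awalk (with_proj G) v p a'"
    using Cons.prems(2) by (cases e) (auto simp: pair_awalk_Cons[OF G])
  have verts: "a \<in> pverts G" "v \<in> pverts G"
    using av by (auto dest: G.in_arcsD1 G.in_arcsD2)
  \<comment> \<open>The entry at \<open>a\<close> gets its final value before \<open>a\<close> is
    left. Hence \<open>a\<close> drops out of the set still to be visited, and the rest of the walk
    covers what remains.\<close>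
  let ?f = "f(a := f' a)"
  have f: "?f \<in> pverts G \<rightarrow>\<^sub>E pverts H"
    using Cons.prems(1) f' verts by (auto simp: PiE_iff extensional_def)
  note W = pair_graph_wreath[OF G H]
  have "((?f, a), (?f, v)) \<in> parcs (wreath G H)"
    using f av verts by (auto simp: wreath_def Let_def)
  then have move: "geodist (wreath G H) (?f, a) (f', a') \<le> 1 + geodist (wreath G H) (?f, v) (f', a')"
    by (rule geodist_step[OF W])
  have "geodist (wreath G H) (?f, v) (f', a')
      \<le> (\<Sum>w\<in>pverts G. geodist H (?f w) (f' w)) + enat (length p)"
    using Cons.prems(3) e by (intro Cons.IH f p) (auto simp: pre_digraph.awalk_verts.simps)
  also have "(\<Sum>w\<in>pverts G. geodist H (?f w) (f' w))
      = (\<Sum>w\<in>pverts G - {a}. geodist H (f w) (f' w))"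
  proof -
    have "geodist H (?f a) (f' a) = 0"
      using f' verts geodist_refl[OF H, of "f' a"] by auto
    then show ?thesis using verts by (simp add: sum.remove[of "pverts G" a])
  qed
  finally have "geodist (wreath G H) (?f, a) (f', a')
      \<le> 1 + ((\<Sum>w\<in>pverts G - {a}. geodist H (f w) (f' w)) + enat (length p))"
    using move by (meson add_left_mono order_trans)
  with geodist_wreath_update[OF G H Cons.prems(1) verts(1), of "f' a"]
  have "geodist (wreath G H) (f, a) (f', a') \<le> geodist H (f a) (f' a)
      + (1 + ((\<Sum>w\<in>pverts G - {a}. geodist H (f w) (f' w)) + enat (length p)))"
    by (meson add_mono geodist_triangle[OF W] order_trans)
  also have "\<dots> = (geodist H (f a) (f' a) + (\<Sum>w\<in>pverts G - {a}. geodist H (f w) (f' w)))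
      + (1 + enat (length p))"
    by (simp add: ac_simps)
  also have "geodist H (f a) (f' a) + (\<Sum>w\<in>pverts G - {a}. geodist H (f w) (f' w))
      = (\<Sum>w\<in>pverts G. geodist H (f w) (f' w))"
    using verts by (simp add: sum.remove[of "pverts G" a])
  finally show ?case by (simp add: one_enat_def)
qed

lemma geodist_wreath:
  assumes G: "pair_graph G" and H: "pair_graph H"
    and fa: "(f, a) \<in> pverts (wreath G H)" and fa': "(f', a') \<in> pverts (wreath G H)"
  shows "geodist (wreath G H) (f, a) (f', a')
    = (\<Sum>w\<in>pverts G. geodist H (f w) (f' w)) + visit_dist G {w \<in> pverts G. f w \<noteq> f' w} a a'"
proof (rule antisym)
  let ?D = "\<lambda>f. {w \<in> pverts G. f w \<noteq> f' w}"
  show "geodist (wreath G H) (f, a) (f', a')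
    \<le> (\<Sum>w\<in>pverts G. geodist H (f w) (f' w)) + visit_dist G (?D f) a a'"
  \<comment> \<open>An infinite right-hand side is trivial; otherwise an optimal covering walk is
    followed.\<close>
  proof (cases "visit_dist G (?D f) a a' = \<infinity>")
    case False
    then obtain p where p: "pre_digraph.awalk (with_proj G) a p a'"
      "?D f \<subseteq> set (pre_digraph.awalk_verts (with_proj G) a p)"
      "visit_dist G (?D f) a a' = enat (length p)"
      by (rule visit_dist_attained)
    then show ?thesis using geodist_wreath_le_walk[OF G H] fa fa' by simp
  qed simp
  define \<phi> where "\<phi> = (\<lambda>(g, v). (\<Sum>w\<in>pverts G. geodist H (g w) (f' w)) + visit_dist G (?D g) v a')"
  interpret G: pair_graph G by fact
  have "\<phi> (f, a) \<le> geodist (wreath G H) (f, a) (f', a')"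
  proof (rule potential_le_geodist)
    show "pair_graph (wreath G H)" using G H by (rule pair_graph_wreath)
    \<comment> \<open>At the target no vertex is left to visit, so the walk term becomes
      \<open>geodist G a' a'\<close>.\<close>
    show "\<phi> (f', a') = 0"
      using fa' G H geodist_refl[OF G, of a']
      by (auto simp: \<phi>_def geodist_refl PiE_iff geodist_eq_visit_dist[symmetric])
  next
    fix s t assume st: "(s, t) \<in> parcs (wreath G H)"
    obtain g v h w where [simp]: "s = (g, v)" "t = (h, w)" by (cases s, cases t)
    from st have v: "v \<in> pverts G" by (auto simp: wreath_def Let_def)
    from st consider
      (lamp) "v = w" "\<forall>z \<in> pverts G. z \<noteq> v \<longrightarrow> g z = h z" "(g v, h v) \<in> parcs H"
      | (move) "g = h" "(v, w) \<in> parcs G"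
      by (auto simp: wreath_def Let_def)
    then show "\<phi> s \<le> 1 + \<phi> t"
    proof cases
      case lamp
      \<comment> \<open>The arc may bring the entry at \<open>v\<close> to its final value, so
        \<open>?D g\<close> can contain \<open>v\<close> when \<open>?D h\<close> does not.
        Elsewhere the two sets agree, and adding \<open>v\<close> is free for walks starting at
        \<open>v\<close>.\<close>
      have "visit_dist G (?D g) v a' \<le> visit_dist G (insert v (?D h)) v a'"
        using lamp by (intro visit_dist_mono) auto
      also have "\<dots> = visit_dist G (?D h) v a'"
        using G by (rule visit_dist_insert_start)
      finally have "visit_dist G (?D g) v a' \<le> visit_dist G (?D h) v a'" .
      moreover have "(\<Sum>w\<in>pverts G. geodist H (g w) (f' w))
          \<le> 1 + (\<Sum>w\<in>pverts G. geodist H (h w) (f' w))"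
        using lamp v by (intro sum_le_one_plus_sum[of _ v] geodist_step[OF H]) auto
      ultimately show ?thesis
        using lamp(1) by (auto simp: \<phi>_def add.assoc[symmetric] intro: add_mono)
    next
      case move
      then show ?thesis
        \<comment> \<open>Here \<open>g = h\<close>: the sum and the set to visit stay the same, and
          only the start of the walk changes.\<close>
        using add_left_mono[OF visit_dist_step[OF G move(2), of "?D h" a'],
            of "\<Sum>w\<in>pverts G. geodist H (h w) (f' w)"]
        by (simp add: \<phi>_def ac_simps)
    qed
  qed
  then show "(\<Sum>w\<in>pverts G. geodist H (f w) (f' w)) + visit_dist G (?D f) a a'
    \<le> geodist (wreath G H) (f, a) (f', a')"
    by (simp add: \<phi>_def)
qed

section \<open>From functions on the vertices to tuples\<close>

theorem theorem4p11:
  fixes G :: "'a pair_pre_digraph" and H :: "'b pair_pre_digraph"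
    and x :: "nat \<Rightarrow> 'a" and n m :: nat
    and f f' :: "'a \<Rightarrow> 'b" and a a' :: 'a
    and y y' :: "nat \<Rightarrow> 'b"
  assumes "pair_graph G" and "Digraph_Component.connected (with_proj G)"
    and "pair_graph H" and "Digraph_Component.connected (with_proj H)"
    and "bij_betw x {1..n} (pverts G)"
    and "card (pverts H) = m"
    and "(f, a) \<in> pverts (wreath G H)"
    and "(f', a') \<in> pverts (wreath G H)"
    and "y = coords n x f"
    and "y' = coords n x f'"
  shows "geodist (wreath G H) (f, a) (f', a')
           = geodist (box_power n H) y y' + visit_dist G (diff_set n x y y') a a'
       \<and> geodist (box_power n H) y y' + visit_dist G (diff_set n x y y') a a'
           = (\<Sum>i = 1..n. geodist H (y i) (y' i)) + visit_dist G (diff_set n x y y') a a'"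
proof -
  have "coords n x g \<in> {1..n} \<rightarrow>\<^sub>E pverts H" if "(g, b) \<in> pverts (wreath G H)" for g b
    using that bij_betwE[OF assms(5)] by (auto simp: coords_def PiE_iff)
  then have box: "geodist (box_power n H) y y' = (\<Sum>i = 1..n. geodist H (y i) (y' i))"
    using assms geodist_box_power by metis
  have "(\<Sum>i = 1..n. geodist H (y i) (y' i)) = (\<Sum>i = 1..n. geodist H (f (x i)) (f' (x i)))"
    using assms(9,10) by (simp add: coords_def)
  \<comment> \<open>The enumeration \<open>x\<close> is a bijection, so summing over indices is
    summing over vertices.\<close>
  also have "\<dots> = (\<Sum>w\<in>pverts G. geodist H (f w) (f' w))"
    using assms(5) by (rule sum.reindex_bij_betw)
  finally have sum: "(\<Sum>i = 1..n. geodist H (y i) (y' i)) = (\<Sum>w\<in>pverts G. geodist H (f w) (f' w))" .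
  \<comment> \<open>Each \<open>y i\<close> is \<open>f (x i)\<close> for \<open>i\<close> in
    \<open>{1..n}\<close>, so tuples differing at index \<open>i\<close> means functions differing
    at the vertex \<open>x i\<close>.\<close>
  have "diff_set n x y y' = {w \<in> x ` {1..n}. f w \<noteq> f' w}"
    using assms(9,10) by (fastforce simp: diff_set_def coords_def)
  also have "x ` {1..n} = pverts G"
    using assms(5) by (rule bij_betw_imp_surj_on)
  finally have "diff_set n x y y' = {w \<in> pverts G. f w \<noteq> f' w}" .
  then show ?thesis
    using geodist_wreath[OF assms(1,3,7,8)] box sum by simp
qed

end
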